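(* Let $f$ be a smooth solution to the heat equation $\frac{\partial}{\partial t}f=\Delta f$ on $B_2(0)\times[0,1]$, where $B_2(0)\subset\mathbb{R}^n$, satisfying $$f(x,t)\,t\le 1\quad\text{for all }(x,t)\in B_1(0)\times[0,1],$$ $$f(x,t)\ge 0\quad\text{for all }x\in B_2(0),\ t\in[0,1],$$ $$\sup_{x\in\overline{B}_1(0)}f(x,0)\,(1-|x|^2)^2\le 1.$$ Then $$\sup_{x\in\overline{B}_1(0)}f(x,t)\big((1-|x|^2)^2-50\,n\,t\big)\le 50\,n\qquad\text{for all }t\in[0,1].$$
   Context: $B_r(0)$ is the open Euclidean ball of radius $r$ centred at the origin of $\mathbb{R}^n$, $\overline{B}_r(0)$ its closure, $|x|$ the Euclidean norm, and $\Delta$ the standard Laplacian on $\mathbb{R}^n$ in the space variable. *)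

theory Defs
  imports "HOL-Analysis.Analysis"
begin

text \<open>
  The derivatives below are taken relative to the domain \<open>S\<close>. For a convex \<open>S\<close> with nonempty
  interior, such as \<open>ball 0 2 \<times> {0..1}\<close>, they are unique, so \<open>smooth_on S f\<close> says that all iterated
  partial derivatives exist and are continuous on \<open>S\<close>; at the two ends of the time interval the
  time derivatives are one-sided.
\<close>

primrec Ck_on :: "nat \<Rightarrow> 'a::real_normed_vector set \<Rightarrow> ('a \<Rightarrow> real) \<Rightarrow> bool" where
  "Ck_on 0 S f \<longleftrightarrow> continuous_on S f"
| "Ck_on (Suc k) S f \<longleftrightarrow>
     (\<exists>f'. (\<forall>x\<in>S. (f has_derivative f' x) (at x within S)) \<and> (\<forall>v. Ck_on k S (\<lambda>x. f' x v)))"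

definition smooth_on :: "'a::real_normed_vector set \<Rightarrow> ('a \<Rightarrow> real) \<Rightarrow> bool" where
  "smooth_on S f \<longleftrightarrow> (\<forall>k. Ck_on k S f)"

definition partial_deriv :: "'n::finite \<Rightarrow> (real ^ 'n \<Rightarrow> real) \<Rightarrow> real ^ 'n \<Rightarrow> real" where
  "partial_deriv i g x = deriv (\<lambda>s. g (x + s *\<^sub>R axis i 1)) 0"

definition laplacian :: "(real ^ 'n::finite \<Rightarrow> real) \<Rightarrow> real ^ 'n \<Rightarrow> real" where
  "laplacian g x = (\<Sum>i\<in>UNIV. partial_deriv i (partial_deriv i g) x)"

end

theory Submission
  imports Defs
begin

text \<open>
  Write \<open>q = 1 - |x|\<^sup>2\<close>. The hypothesis \<open>f t \<le> 1\<close> settles the claim wherever \<open>q\<^sup>2 \<le> 100 n t\<close>: the factor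
  \<open>q\<^sup>2 - 50 n t\<close> is then at most \<open>50 n t\<close>. It remains to bound \<open>f\<close> where \<open>q\<^sup>2\<close> is large compared with
  \<open>n t\<close>, and there \<open>f\<close> is compared with the explicit barrier
  \[ B(x,t) = \frac{1}{q^2} + \frac{(90 n)^2\, t}{q^4}. \]

  Since \<open>\<Delta> q\<^sup>-\<^sup>2 \<le> 24 n q\<^sup>-\<^sup>4\<close> and \<open>\<Delta> q\<^sup>-\<^sup>4 \<le> 80 n q\<^sup>-\<^sup>6\<close>, the time derivative \<open>(90 n)\<^sup>2 q\<^sup>-\<^sup>4\<close> of \<open>B\<close>
  dominates \<open>\<Delta> B\<close> as long as \<open>t / q\<^sup>2\<close> stays safely below \<open>1 / (80 n)\<close>; on the region \<open>q\<^sup>2 \<ge> 90 n t\<close>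
  the function \<open>B\<close> is therefore a strict supersolution of the heat equation
  (\<open>barrier_strict_supersolution\<close>). On the parabolic boundary of this region \<open>B\<close> lies above \<open>f\<close>: at
  \<open>t = 0\<close> by the hypothesis on the initial values, on the lateral part \<open>q\<^sup>2 = 90 n t\<close> because the second
  summand equals \<open>1 / t\<close> there, and near \<open>|x| = 1\<close> because \<open>f\<close> is bounded while \<open>B\<close> blows up. The
  maximum principle gives \<open>f \<le> B\<close> on the region (\<open>heat_le_barrier\<close>), and the claim follows from the
  quadratic inequality behind \<open>barrier_times_weight_le\<close>.

  The number 90 has to lie above 80, so that \<open>B\<close> is a supersolution, and at most 100, so that the two
  regions cover everything. For \<open>n \<ge> 2\<close> the maximum principle could be applied to
  \<open>F = f (q\<^sup>2 - 50 n t)\<close> itself. For \<open>n = 1\<close>, however, at a spatial maximum with \<open>F \<ge> 50\<close> the bound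
  \<open>f t \<le> 1\<close> only yields \<open>F\<^sub>t - \<Delta> F \<le> f (52 |x|\<^sup>2 - 46)\<close>, which has the wrong sign near \<open>|x| = 1\<close>.
\<close>

section \<open>Second derivatives along a line and the parabolic maximum principle\<close>

text \<open>
  The second derivative at a point asks for a first derivative on a whole neighbourhood, and an
  explicit witness for it is easier to subtract and to compare than a nested \<open>deriv\<close>.
\<close>

definition has_second_deriv0 :: "(real \<Rightarrow> real) \<Rightarrow> real \<Rightarrow> bool" where
  "has_second_deriv0 h c \<longleftrightarrow>
     (\<exists>g e. e > 0 \<and> (\<forall>s. \<bar>s\<bar> < e \<longrightarrow> (h has_real_derivative g s) (at s)) \<and>
        (g has_real_derivative c) (at 0))"

lemma has_second_deriv0_diff:
  assumes "has_second_deriv0 h c" and "has_second_deriv0 k d"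
  shows "has_second_deriv0 (\<lambda>s. h s - k s) (c - d)"
proof -
  obtain g e where g: "e > 0" "\<And>s. \<bar>s\<bar> < e \<Longrightarrow> (h has_real_derivative g s) (at s)"
    "(g has_real_derivative c) (at 0)"
    using assms(1) unfolding has_second_deriv0_def by blast
  obtain l e' where l: "e' > 0" "\<And>s. \<bar>s\<bar> < e' \<Longrightarrow> (k has_real_derivative l s) (at s)"
    "(l has_real_derivative d) (at 0)"
    using assms(2) unfolding has_second_deriv0_def by blast
  show ?thesis
    unfolding has_second_deriv0_def
  proof (intro exI[of _ "\<lambda>s. g s - l s"] exI[of _ "min e e'"] conjI allI impI)
    show "min e e' > 0" using g l by simp
    show "((\<lambda>s. h s - k s) has_real_derivative g s - l s) (at s)" if "\<bar>s\<bar> < min e e'" for s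
      using that g(2) l(2) by (intro DERIV_diff) auto
    show "((\<lambda>s. g s - l s) has_real_derivative c - d) (at 0)"
      using g(3) l(3) by (rule DERIV_diff)
  qed
qed

text \<open>
  If \<open>c > 0\<close>, the first derivative, which vanishes at the maximum, would be positive just to the
  right of it, so that \<open>h\<close> would increase there.
\<close>
lemma second_deriv0_nonpos_at_max:
  assumes "has_second_deriv0 h c" and "e > 0" and max: "\<And>s. \<bar>s\<bar> < e \<Longrightarrow> h s \<le> h 0"
  shows "c \<le> 0"
proof (rule ccontr)
  assume "\<not> c \<le> 0"
  obtain g e' where g: "e' > 0" "\<And>s. \<bar>s\<bar> < e' \<Longrightarrow> (h has_real_derivative g s) (at s)"
    "(g has_real_derivative c) (at 0)"
    using assms(1) unfolding has_second_deriv0_def by blast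
  have "g 0 = 0"
    using DERIV_local_max[of h "g 0" 0 e] g(1,2) \<open>e > 0\<close> max by simp
  obtain d where d: "d > 0" "\<And>s. 0 < s \<Longrightarrow> s < d \<Longrightarrow> g s > 0"
    using DERIV_pos_inc_right[OF g(3)] \<open>\<not> c \<le> 0\<close> \<open>g 0 = 0\<close> by auto
  define r where "r = min d (min e e') / 2"
  have r: "0 < r" "r < d" "r < e" "r < e'"
    using d(1) g(1) \<open>e > 0\<close> by (auto simp: r_def)
  obtain z where z: "0 < z" "z < r" "h r - h 0 = (r - 0) * g z"
    using MVT2[of 0 r h g] g(2) r by auto
  have "h r - h 0 > 0"
    using z d(2)[of z] r by simp
  moreover have "h r \<le> h 0"
    using max r by simp
  ultimately show False by simp
qed

text \<open>
  At a positive maximum of \<open>w\<close> over \<open>K\<close> the time derivative from the left is nonnegative and the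
  second derivatives along the axes are nonpositive, against \<open>w\<^sub>t < \<Delta> w\<close>. Derivatives are required only
  at points where \<open>w > 0\<close>, and only a backward time interval and a spatial ball have to stay in \<open>K\<close>.
  So the parabolic boundary of \<open>K\<close> needs no description: it is enough that \<open>w \<le> 0\<close> there. Time
  slices at the final time are covered as well.
\<close>
lemma parabolic_maximum_principle:
  fixes w :: "real ^ 'n::finite \<Rightarrow> real \<Rightarrow> real"
  assumes "compact K" and "continuous_on K (\<lambda>(x, t). w x t)"
    and interior: "\<And>x t. (x, t) \<in> K \<Longrightarrow> w x t > 0 \<Longrightarrow>
      \<exists>e>0. \<exists>a c. {x} \<times> {t-e..t} \<subseteq> K \<and> ball x e \<times> {t} \<subseteq> K \<and>
        (w x has_real_derivative a) (at t within {t-e..t}) \<and>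
        (\<forall>i. has_second_deriv0 (\<lambda>s. w (x + s *\<^sub>R axis i 1) t) (c i)) \<and> a < (\<Sum>i\<in>UNIV. c i)"
    and "(x, t) \<in> K"
  shows "w x t \<le> 0"
proof (rule ccontr)
  assume "\<not> w x t \<le> 0"
  obtain p where p: "p \<in> K" "\<And>q. q \<in> K \<Longrightarrow> (case q of (x, t) \<Rightarrow> w x t) \<le> (case p of (x, t) \<Rightarrow> w x t)"
    using continuous_attains_sup[OF assms(1) _ assms(2)] assms(4) by blast
  obtain y u where yu: "p = (y, u)" by (cases p)
  have max: "w z s \<le> w y u" if "(z, s) \<in> K" for z s
    using p(2)[OF that] yu by simp
  have "w y u > 0"
    using max[OF assms(4)] \<open>\<not> w x t \<le> 0\<close> by simp
  then obtain e a c where e: "e > 0" and K: "{y} \<times> {u-e..u} \<subseteq> K" "ball y e \<times> {u} \<subseteq> K"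
    and a: "(w y has_real_derivative a) (at u within {u-e..u})"
    and c: "\<And>i. has_second_deriv0 (\<lambda>s. w (y + s *\<^sub>R axis i 1) u) (c i)"
    and ac: "a < (\<Sum>i\<in>UNIV. c i)"
    using interior[of y u] p(1) yu by blast
  have "c i \<le> 0" for i
  proof (rule second_deriv0_nonpos_at_max[OF c e])
    fix s :: real assume "\<bar>s\<bar> < e"
    then have "y + s *\<^sub>R axis i 1 \<in> ball y e"
      by (simp add: dist_norm norm_axis_1)
    then show "w (y + s *\<^sub>R axis i 1) u \<le> w (y + 0 *\<^sub>R axis i 1) u"
      using K(2) by (subst scaleR_zero_left, subst add_0_right, intro max) auto
  qed
  then have "(\<Sum>i\<in>UNIV. c i) \<le> 0"
    by (intro sum_nonpos) auto
  then have "a < 0" using ac by simp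
  then obtain d where d: "d > 0" "\<And>h. h > 0 \<Longrightarrow> u - h \<in> {u-e..u} \<Longrightarrow> h < d \<Longrightarrow> w y u < w y (u - h)"
    using has_real_derivative_neg_dec_left[OF a] by blast
  define h where "h = min d e / 2"
  have h: "h > 0" "h < d" "h < e" using d(1) e by (auto simp: h_def)
  have "w y u < w y (u - h)" using d(2)[of h] h by auto
  moreover have "w y (u - h) \<le> w y u" using K(1) h by (intro max) auto
  ultimately show False by simp
qed

section \<open>Second partial derivatives of a smooth function on a space-time domain\<close>

text \<open>
  A derivative relative to \<open>U \<times> I\<close> determines a genuine two-sided derivative along a spatial line,
  because the line stays in the domain near \<open>y\<close> even when \<open>t\<close> is an end point of \<open>I\<close>.
\<close>
lemma has_derivative_imp_spatial_line_deriv: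
  fixes F :: "'a::real_normed_vector \<times> real \<Rightarrow> real"
  assumes F: "(F has_derivative F') (at (y, t) within U \<times> I)" and "open U" "y \<in> U" "t \<in> I"
  shows "((\<lambda>s. F (y + s *\<^sub>R v, t)) has_real_derivative F' (v, 0)) (at 0)"
proof -
  define T where "T = (\<lambda>s. y + s *\<^sub>R v) -` U"
  have "open T"
    unfolding T_def by (intro continuous_open_vimage \<open>open U\<close> continuous_intros)
  have "0 \<in> T" using \<open>y \<in> U\<close> by (simp add: T_def)
  have l: "((\<lambda>s. (y + s *\<^sub>R v, t)) has_derivative (\<lambda>s. (s *\<^sub>R v, 0))) (at 0 within T)"
    by (auto intro!: derivative_eq_intros)
  have "((\<lambda>s. F (y + s *\<^sub>R v, t)) has_derivative (\<lambda>s. F' (s *\<^sub>R v, 0))) (at 0 within T)"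
  proof (rule has_derivative_in_compose[OF l])
    show "(F has_derivative F') (at (y + 0 *\<^sub>R v, t) within (\<lambda>s. (y + s *\<^sub>R v, t)) ` T)"
      using F \<open>t \<in> I\<close> by (simp, elim has_derivative_subset) (auto simp: T_def)
  qed
  moreover have "F' (s *\<^sub>R v, 0) = F' (v, 0) * s" for s
  proof -
    have "F' (s *\<^sub>R (v, 0)) = s *\<^sub>R F' (v, 0)"
      using F by (intro linear_cmul has_derivative_linear)
    then show ?thesis by (simp add: mult.commute)
  qed
  ultimately have "((\<lambda>s. F (y + s *\<^sub>R v, t)) has_derivative (*) (F' (v, 0))) (at 0 within T)"
    by (simp only:)
  then show ?thesis
    unfolding has_field_derivative_def at_within_open[OF \<open>0 \<in> T\<close> \<open>open T\<close>] .
qed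

text \<open>
  The operators \<open>partial_deriv\<close> are total, so their values mean something only once the
  differentiability behind them is known. For smooth \<open>f\<close> they agree with the total derivatives applied
  to the axis vectors.
\<close>
lemma smooth_imp_second_partial_deriv:
  fixes f :: "real ^ 'n::finite \<Rightarrow> real \<Rightarrow> real"
  assumes smooth: "smooth_on (U \<times> I) (\<lambda>(x, t). f x t)"
    and "open U" and "x \<in> U" and "t \<in> I"
  shows "has_second_deriv0 (\<lambda>s. f (x + s *\<^sub>R axis i 1) t)
    (partial_deriv i (partial_deriv i (\<lambda>y. f y t)) x)"
proof -
  have "Ck_on (Suc (Suc 0)) (U \<times> I) (\<lambda>(x, t). f x t)"
    using smooth unfolding smooth_on_def by blast
  then obtain f' where f': "\<And>z. z \<in> U \<times> I \<Longrightarrow> ((\<lambda>(x, t). f x t) has_derivative f' z) (at z within U \<times> I)"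
    and C1: "\<And>v. Ck_on (Suc 0) (U \<times> I) (\<lambda>z. f' z v)"
    by auto
  define e :: "real ^ 'n" where "e = axis i 1"
  obtain f'' where f'': "\<And>z. z \<in> U \<times> I \<Longrightarrow> ((\<lambda>z. f' z (e, 0)) has_derivative f'' z) (at z within U \<times> I)"
    using C1[of "(e, 0)"] by auto
  have D1: "((\<lambda>s. f (y + s *\<^sub>R e) t) has_real_derivative f' (y, t) (e, 0)) (at 0)" if "y \<in> U" for y
    using has_derivative_imp_spatial_line_deriv[OF f' \<open>open U\<close> that \<open>t \<in> I\<close>, of e] that \<open>t \<in> I\<close> by simp
  have p: "partial_deriv i (\<lambda>y. f y t) y = f' (y, t) (e, 0)" if "y \<in> U" for y
    using D1[OF that] unfolding partial_deriv_def e_def by (rule DERIV_imp_deriv)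
  have D2: "((\<lambda>s. f' (x + s *\<^sub>R e, t) (e, 0)) has_real_derivative f'' (x, t) (e, 0)) (at 0)"
    using has_derivative_imp_spatial_line_deriv[OF f'' \<open>open U\<close> \<open>x \<in> U\<close> \<open>t \<in> I\<close>, of e] assms by simp
  obtain r where r: "r > 0" "ball x r \<subseteq> U"
    using \<open>open U\<close> \<open>x \<in> U\<close> open_contains_ball by blast
  have inU: "x + s *\<^sub>R e \<in> U" if "\<bar>s\<bar> < r" for s
    using that r(2) by (auto simp: e_def dist_norm norm_axis_1 subset_iff)
  \<comment> \<open>To differentiate once more, the identity for the first partial derivative is needed near \<open>x\<close>.\<close>
  have "eventually (\<lambda>s. s \<in> {-r<..<r}) (nhds (0::real))"
    using r(1) by (intro eventually_nhds_in_open) auto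
  then have "eventually (\<lambda>s. partial_deriv i (\<lambda>y. f y t) (x + s *\<^sub>R e) = f' (x + s *\<^sub>R e, t) (e, 0)) (nhds 0)"
    by eventually_elim (auto intro!: p inU)
  then have "((\<lambda>s. partial_deriv i (\<lambda>y. f y t) (x + s *\<^sub>R e)) has_real_derivative f'' (x, t) (e, 0)) (at 0)"
    using D2 by (subst DERIV_cong_ev) auto
  then have pp: "partial_deriv i (partial_deriv i (\<lambda>y. f y t)) x = f'' (x, t) (e, 0)"
    unfolding partial_deriv_def[of _ "partial_deriv i (\<lambda>y. f y t)"] e_def by (rule DERIV_imp_deriv)
  show ?thesis
    unfolding has_second_deriv0_def pp e_def[symmetric]
  proof (intro exI[of _ "\<lambda>s. f' (x + s *\<^sub>R e, t) (e, 0)"] exI[of _ r] conjI allI impI)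
    fix s assume "\<bar>s\<bar> < r"
    from D1[OF inU[OF this]]
    have "((\<lambda>h. f (x + (s + h) *\<^sub>R e) t) has_real_derivative f' (x + s *\<^sub>R e, t) (e, 0)) (at 0)"
      by (simp add: algebra_simps)
    then show "((\<lambda>s. f (x + s *\<^sub>R e) t) has_real_derivative f' (x + s *\<^sub>R e, t) (e, 0)) (at s)"
      using DERIV_at_within_shift[of "\<lambda>s. f (x + s *\<^sub>R e) t" _ s 0 UNIV] by (simp add: add.commute)
  qed (use r D2 in auto)
qed

section \<open>The barrier\<close>

text \<open>How far \<open>|x|\<^sup>2\<close> falls short of 1: the function written \<open>q\<close> in the introduction.\<close>
definition defect :: "real ^ 'n::finite \<Rightarrow> real" where
  "defect x = 1 - (norm x)\<^sup>2"

text \<open>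
  Up to the factor \<open>1 / q\<^sup>2\<close> this is an affine function of the parabolically scale-invariant ratio
  \<open>t / q\<^sup>2\<close>. The first summand matches the initial bound. The second supplies the positive time derivative
  that makes up for the positive Laplacian, and its coefficient \<open>8100 n\<^sup>2 = (90 n)\<^sup>2\<close> turns it into
  \<open>1 / t\<close> on the surface \<open>q\<^sup>2 = 90 n t\<close>.
\<close>
definition barrier :: "real ^ 'n::finite \<Rightarrow> real \<Rightarrow> real" where
  "barrier x t = 1 / (defect x)\<^sup>2 + 8100 * (real CARD('n))\<^sup>2 * t / defect x ^ 4"

lemma continuous_on_defect [continuous_intros]:
  "continuous_on S g \<Longrightarrow> continuous_on S (\<lambda>z. defect (g z))"
  unfolding defect_def by (intro continuous_intros)

lemma defect_line:
  "defect (x + s *\<^sub>R axis i 1) = defect x - 2 * s * x $ i - s\<^sup>2"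
  unfolding defect_def power2_norm_eq_inner
  by (simp add: inner_add_left inner_add_right inner_axis inner_axis' algebra_simps power2_eq_square)

text \<open>
  On a line parallel to the axis \<open>i\<close> the defect is a quadratic polynomial in the parameter, so the
  barrier becomes a rational function of one variable.
\<close>
lemma barrier_second_deriv:
  fixes x :: "real ^ 'n::finite"
  assumes "defect x > 0"
  shows "has_second_deriv0 (\<lambda>s. barrier (x + s *\<^sub>R axis i 1) t)
    (4 / defect x ^ 3 + 24 * (x $ i)\<^sup>2 / defect x ^ 4
     + 8100 * (real CARD('n))\<^sup>2 * t * (8 / defect x ^ 5 + 80 * (x $ i)\<^sup>2 / defect x ^ 6))"
proof -
  define d where "d = defect x"
  define \<xi> where "\<xi> = x $ i"
  define q where "q s = d - 2 * s * \<xi> - s\<^sup>2" for s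
  define D where "D = 8100 * (real CARD('n))\<^sup>2 * t"
  define g where "g s = 4 * (\<xi> + s) / q s ^ 3 + D * (8 * (\<xi> + s) / q s ^ 5)" for s
  have "d > 0" using assms by (simp add: d_def)
  have "eventually (\<lambda>s. q s > 0) (nhds 0)"
  proof -
    have "isCont q 0" unfolding q_def by (intro continuous_intros)
    then have "(q \<longlongrightarrow> q 0) (nhds 0)"
      unfolding isCont_def tendsto_at_iff_tendsto_nhds .
    then show ?thesis by (rule order_tendstoD) (simp add: q_def \<open>d > 0\<close>)
  qed
  then obtain e where e: "e > 0" "\<And>s. \<bar>s\<bar> < e \<Longrightarrow> q s > 0"
    unfolding eventually_nhds_metric by (auto simp: dist_norm)
  have q': "(q has_real_derivative - 2 * (\<xi> + s)) (at s)" for s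
    unfolding q_def by (auto intro!: derivative_eq_intros)
  have "((\<lambda>s. 1 / (q s)\<^sup>2 + D / q s ^ 4) has_real_derivative g s) (at s)" if "\<bar>s\<bar> < e" for s
    using e(2)[OF that]
    by (auto intro!: derivative_eq_intros q' simp: g_def field_simps power_numeral_reduce)
  moreover have "(g has_real_derivative 4 / d ^ 3 + 24 * \<xi>\<^sup>2 / d ^ 4 + D * (8 / d ^ 5 + 80 * \<xi>\<^sup>2 / d ^ 6)) (at 0)"
  proof -
    have "q 0 = d" by (simp add: q_def)
    then show ?thesis using \<open>d > 0\<close> unfolding g_def
    by (auto intro!: derivative_eq_intros q' simp: field_simps power_numeral_reduce)
  qed
  ultimately show ?thesis
    unfolding has_second_deriv0_def barrier_def defect_line d_def[symmetric] \<xi>_def[symmetric]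
      D_def[symmetric] q_def[symmetric]
    using e(1) by (intro exI[of _ g] exI[of _ e] conjI allI impI)
qed

text \<open>
  Summed over \<open>i\<close>, the terms of order zero in \<open>t\<close> are at most \<open>24 n / q\<^sup>4\<close>, and those linear in \<open>t\<close> at
  most \<open>8100 n\<^sup>2 \<cdot> 80 n t / q\<^sup>6\<close>. The latter use up no more than \<open>8/9\<close> of the time derivative when
  \<open>90 n t \<le> q\<^sup>2\<close>, and the remaining \<open>900 n\<^sup>2 / q\<^sup>4\<close> exceeds \<open>24 n / q\<^sup>4\<close>.
\<close>
lemma barrier_strict_supersolution:
  fixes x :: "real ^ 'n::finite"
  assumes q: "defect x > 0" and t: "t \<ge> 0" and qt: "90 * real CARD('n) * t \<le> (defect x)\<^sup>2"
  shows "(\<Sum>i\<in>UNIV. 4 / defect x ^ 3 + 24 * (x $ i)\<^sup>2 / defect x ^ 4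
     + 8100 * (real CARD('n))\<^sup>2 * t * (8 / defect x ^ 5 + 80 * (x $ i)\<^sup>2 / defect x ^ 6))
     < 8100 * (real CARD('n))\<^sup>2 / defect x ^ 4"
proof -
  define n where "n = real CARD('n)"
  define d where "d = defect x"
  define D where "D = 8100 * n\<^sup>2"
  define X where "X = (norm x)\<^sup>2"
  have n: "n \<ge> 1" unfolding n_def by (simp add: Suc_leI)
  have d: "d > 0" "d = 1 - X" using q by (simp_all add: d_def defect_def X_def)
  have X: "X \<ge> 0" "X = (\<Sum>i\<in>UNIV. (x $ i)\<^sup>2)"
    unfolding X_def by (simp, simp add: power2_norm_eq_inner inner_vec_def power2_eq_square[symmetric])
  have "(\<Sum>i\<in>UNIV. 4 / d ^ 3 + 24 * (x $ i)\<^sup>2 / d ^ 4 + D * t * (8 / d ^ 5 + 80 * (x $ i)\<^sup>2 / d ^ 6))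
      = n * (4 / d ^ 3) + 24 * X / d ^ 4 + D * t * (n * (8 / d ^ 5) + 80 * X / d ^ 6)"
    unfolding X(2) n_def
    by (simp add: sum.distrib sum_distrib_left[symmetric] sum_divide_distrib[symmetric] distrib_left)
  also have "\<dots> = (4 * n * d + 24 * X + D * (t / d\<^sup>2) * (8 * n * d + 80 * X)) / d ^ 4"
    using d(1) by (simp add: field_simps power_numeral_reduce)
  also have "\<dots> < D / d ^ 4"
  proof (rule divide_strict_right_mono)
    \<comment> \<open>Both sums are convex combinations, with weights \<open>d\<close> and \<open>X\<close>, and \<open>n \<ge> 1\<close> lets \<open>24 n\<close>, \<open>80 n\<close> dominate.\<close>
    have nX: "X \<le> n * X" using mult_right_mono[OF n X(1)] by simp
    have nX1: "n * X \<le> n" using mult_left_mono[of X 1 n] n d by simp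
    have le24: "4 * n * d + 24 * X \<le> 24 * n"
      using nX nX1 n X(1) unfolding d(2) by (simp add: algebra_simps)
    have le80: "8 * n * d + 80 * X \<le> 80 * n"
      using nX nX1 n X(1) unfolding d(2) by (simp add: algebra_simps)
    have s0: "t / d\<^sup>2 \<ge> 0" using t by simp
    have "t / d\<^sup>2 * (8 * n * d + 80 * X) \<le> t / d\<^sup>2 * (80 * n)"
      using le80 s0 by (rule mult_left_mono)
    also have "\<dots> \<le> 8 / 9"
      using qt d(1) by (simp add: field_simps n_def d_def)
    finally have "D * (t / d\<^sup>2 * (8 * n * d + 80 * X)) \<le> D * (8 / 9)"
      by (rule mult_left_mono) (simp add: D_def)
    moreover have "24 * n < D / 9"
      using n by (simp add: D_def power2_eq_square)
    ultimately show "4 * n * d + 24 * X + D * (t / d\<^sup>2) * (8 * n * d + 80 * X) < D"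
      using le24 unfolding mult.assoc by linarith
    show "0 < d ^ 4" using d by simp
  qed
  finally show ?thesis by (simp add: d_def n_def D_def)
qed

lemma barrier_le_on_initial_and_lateral:
  fixes x :: "real ^ 'n::finite"
  assumes "defect x > 0" "t \<ge> 0"
  shows "1 / (defect x)\<^sup>2 \<le> barrier x t"
    and "90 * real CARD('n) * t = (defect x)\<^sup>2 \<Longrightarrow> 1 / t \<le> barrier x t"
proof -
  show "1 / (defect x)\<^sup>2 \<le> barrier x t"
    using assms by (simp add: barrier_def)
  assume eq: "90 * real CARD('n) * t = (defect x)\<^sup>2"
  then have "t > 0" using assms by (metis less_eq_real_def mult_zero_right power_eq_0_iff less_irrefl)
  have "defect x ^ 4 = (90 * real CARD('n) * t)\<^sup>2" unfolding eq by simp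
  then have "8100 * (real CARD('n))\<^sup>2 * t / defect x ^ 4 = 1 / t"
    using \<open>t > 0\<close> by (simp add: field_simps power2_eq_square)
  then show "1 / t \<le> barrier x t"
    by (simp add: barrier_def)
qed

text \<open>
  With \<open>u = n t / q\<^sup>2\<close> and \<open>n \<ge> 1\<close> the claim reduces to \<open>(1 + 8100 u) (1 - 50 u) \<le> 50\<close>. This quadratic in
  \<open>u\<close> has its maximum, about 41, at \<open>u = 161/16200\<close>.
\<close>
lemma barrier_times_weight_le:
  fixes x :: "real ^ 'n::finite"
  assumes "defect x > 0" "50 * real CARD('n) * t \<le> (defect x)\<^sup>2"
  shows "barrier x t * ((defect x)\<^sup>2 - 50 * real CARD('n) * t) \<le> 50 * real CARD('n)"
proof -
  define n where "n = real CARD('n)"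
  define d where "d = defect x"
  define u where "u = n * t / d\<^sup>2"
  have n: "n \<ge> 1" unfolding n_def by (simp add: Suc_leI)
  have d: "d > 0" using assms by (simp add: d_def)
  have u: "50 * u \<le> 1" using assms d by (simp add: u_def n_def d_def field_simps)
  have "barrier x t * (d\<^sup>2 - 50 * n * t) = (1 + n * 8100 * u) * (1 - 50 * u)"
    using d unfolding barrier_def d_def[symmetric] n_def[symmetric] u_def
    by (simp add: field_simps power_numeral_reduce)
  also have "\<dots> \<le> n * ((1 + 8100 * u) * (1 - 50 * u))"
    using mult_right_mono[of "1 + n * 8100 * u" "n * (1 + 8100 * u)" "1 - 50 * u"] n u
    by (simp add: algebra_simps)
  also have "(1 + 8100 * u) * (1 - 50 * u) \<le> 50"
    using zero_le_power2[of "u - 161/16200"] u by (simp add: algebra_simps power2_eq_square)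
  finally show ?thesis using n unfolding n_def d_def by simp
qed

section \<open>Comparison of the solution with the barrier\<close>

text \<open>
  The maximum principle is applied to \<open>f - B\<close> on the part of \<open>q\<^sup>2 \<ge> 90 n t\<close> where also \<open>q \<ge> \<delta>\<close>. The
  cut-off makes this set compact and keeps it away from the singularity of \<open>B\<close>; it costs nothing if
  \<open>1 / \<delta>\<^sup>2\<close> is at least a bound \<open>M\<close> for \<open>f\<close>, since then \<open>f \<le> M \<le> B\<close> where \<open>q = \<delta>\<close>.
\<close>
lemma heat_le_barrier:
  fixes f :: "real ^ 'n::finite \<Rightarrow> real \<Rightarrow> real"
  assumes smooth: "smooth_on (ball 0 2 \<times> {0..1}) (\<lambda>(x, t). f x t)"
    and heat: "\<And>x t. x \<in> ball 0 2 \<Longrightarrow> t \<in> {0..1} \<Longrightarrow>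
      ((\<lambda>s. f x s) has_real_derivative laplacian (\<lambda>y. f y t) x) (at t within {0..1})"
    and decay: "\<And>x t. x \<in> ball 0 1 \<Longrightarrow> t \<in> {0..1} \<Longrightarrow> f x t * t \<le> 1"
    and initial: "\<And>x. x \<in> ball 0 1 \<Longrightarrow> f x 0 * (defect x)\<^sup>2 \<le> 1"
    and x: "x \<in> ball 0 1" and t: "t \<in> {0..1}" and xt: "90 * real CARD('n) * t \<le> (defect x)\<^sup>2"
  shows "f x t \<le> barrier x t"
proof -
  have ball: "z \<in> ball 0 1 \<longleftrightarrow> defect z > 0" for z :: "real ^ 'n"
    by (simp add: defect_def abs_square_less_1)
  have ball2: "z \<in> ball 0 2" if "defect z > 0" for z :: "real ^ 'n"
    using that ball[of z] by auto
  have "Ck_on 0 (ball 0 2 \<times> {0..1}) (\<lambda>(x, t). f x t)"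
    using smooth unfolding smooth_on_def by blast
  then have cont: "continuous_on (ball 0 2 \<times> {0..1}) (\<lambda>(x, t). f x t)" by simp
  have "compact (cball (0 :: real ^ 'n) 1 \<times> {0..1::real})"
    by (intro compact_Times compact_cball compact_Icc)
  moreover have "cball (0 :: real ^ 'n) 1 \<times> {0..1::real} \<subseteq> ball 0 2 \<times> {0..1}" by auto
  ultimately have "bounded ((\<lambda>(x, t). f x t) ` (cball 0 1 \<times> {0..1}))"
    using cont by (intro compact_imp_bounded compact_continuous_image) (auto intro: continuous_on_subset)
  then obtain M where "M > 0"
    and *: "\<forall>v\<in>(\<lambda>(x, t). f x t) ` (cball 0 1 \<times> {0..1}). norm v \<le> M"
    unfolding bounded_pos by blast
  note M = this(1)
  have fM: "f z s \<le> M" if "z \<in> cball 0 1" "s \<in> {0..1}" for z s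
  proof -
    have "f z s \<in> (\<lambda>(x, t). f x t) ` (cball 0 1 \<times> {0..1})"
      using that by (intro image_eqI[of _ _ "(z, s)"]) simp_all
    then have "norm (f z s) \<le> M" using * by blast
    then show ?thesis by simp
  qed
  define \<delta> where "\<delta> = min (defect x) (1 / sqrt M)"
  have \<delta>: "\<delta> > 0" "\<delta> \<le> defect x" using x M ball by (auto simp: \<delta>_def)
  have M\<delta>: "M \<le> 1 / \<delta>\<^sup>2"
  proof -
    have "\<delta>\<^sup>2 \<le> (1 / sqrt M)\<^sup>2" using \<delta>(1) by (intro power_mono) (auto simp: \<delta>_def)
    then show ?thesis using M \<delta>(1) by (simp add: field_simps)
  qed
  \<comment> \<open>Closed under decreasing time, so backward time intervals from its points stay inside.\<close>
  define K where "K = {(z :: real ^ 'n, s :: real). s \<in> {0..1} \<and> \<delta> \<le> defect z \<and> 90 * real CARD('n) * s \<le> (defect z)\<^sup>2}"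
  have Kball: "K \<subseteq> cball 0 1 \<times> {0..1}"
  proof clarify
    fix z s assume "(z, s) \<in> K"
    then have "defect z > 0" "s \<in> {0..1}" using \<delta>(1) by (auto simp: K_def)
    then show "z \<in> cball 0 1 \<and> s \<in> {0..1}" using ball[of z] by simp
  qed
  have "closed K"
    unfolding K_def case_prod_beta atLeastAtMost_iff
    by (intro closed_Collect_conj closed_Collect_le continuous_intros)
  then have "compact K"
    using Kball \<open>compact (cball 0 1 \<times> {0..1})\<close> by (metis compact_Int_closed inf.absorb_iff2)
  have Kpos: "defect (fst p) > 0" if "p \<in> K" for p using that \<delta>(1) by (auto simp: K_def)
  have "f x t - barrier x t \<le> 0"
  proof (rule parabolic_maximum_principle[OF \<open>compact K\<close>, of "\<lambda>x t. f x t - barrier x t"])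
    have "continuous_on K (\<lambda>(x, t). f x t)"
      using cont by (rule continuous_on_subset) (use Kball in force)
    moreover have "continuous_on K (\<lambda>p. barrier (fst p) (snd p))"
      unfolding barrier_def by (intro continuous_intros) (auto dest: Kpos)
    ultimately show "continuous_on K (\<lambda>(x, t). f x t - barrier x t)"
      by (simp add: case_prod_beta continuous_on_diff)
    show "(x, t) \<in> K" using \<delta> t xt by (simp add: K_def)
  next
    fix y u assume yu: "(y, u) \<in> K" and pos: "f y u - barrier y u > 0"
    have u: "0 \<le> u" "u \<le> 1" and y: "\<delta> \<le> defect y" "defect y > 0"
      and qu: "90 * real CARD('n) * u \<le> (defect y)\<^sup>2"
      using yu Kpos[OF yu] by (auto simp: K_def)
    have y1: "y \<in> ball 0 1" "y \<in> ball 0 2" using ball ball2 y by auto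
    note barrier = barrier_le_on_initial_and_lateral[OF y(2) u(1)]
    \<comment> \<open>A point where \<open>f\<close> exceeds the barrier lies on no part of the parabolic boundary.\<close>
    have "u \<noteq> 0"
    proof
      assume "u = 0"
      then have "f y u \<le> 1 / (defect y)\<^sup>2"
        using initial[OF y1(1)] y(2) by (simp add: field_simps)
      then show False using barrier(1) pos by simp
    qed
    then have "u > 0" using u by simp
    have "\<delta> \<noteq> defect y"
    proof
      assume "\<delta> = defect y"
      then have "f y u \<le> 1 / (defect y)\<^sup>2" using M\<delta> fM[of y u] y1 u by simp
      then show False using barrier(1) pos by simp
    qed
    have "90 * real CARD('n) * u \<noteq> (defect y)\<^sup>2"
    proof
      assume eq: "90 * real CARD('n) * u = (defect y)\<^sup>2"
      have "f y u \<le> 1 / u" using decay[OF y1(1), of u] u \<open>u > 0\<close> by (simp add: field_simps)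
      then show False using barrier(2)[OF eq] pos by simp
    qed
    define V where "V = {z :: real ^ 'n. \<delta> < defect z \<and> 90 * real CARD('n) * u < (defect z)\<^sup>2}"
    have "open V"
      unfolding V_def by (intro open_Collect_conj open_Collect_less continuous_intros)
    moreover have "y \<in> V"
      using y qu \<open>\<delta> \<noteq> defect y\<close> \<open>90 * real CARD('n) * u \<noteq> (defect y)\<^sup>2\<close> by (simp add: V_def)
    ultimately obtain r where r: "r > 0" "ball y r \<subseteq> V"
      using open_contains_ball by blast
    define e where "e = min r u"
    have e: "e > 0" "e \<le> r" "e \<le> u" using r \<open>u > 0\<close> by (auto simp: e_def)
    have sub: "{u-e..u} \<subseteq> {0..1}" using e u by auto
    define c where "c i = partial_deriv i (partial_deriv i (\<lambda>z. f z u)) y -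
       (4 / defect y ^ 3 + 24 * (y $ i)\<^sup>2 / defect y ^ 4
     + 8100 * (real CARD('n))\<^sup>2 * u * (8 / defect y ^ 5 + 80 * (y $ i)\<^sup>2 / defect y ^ 6))" for i
    define a where "a = laplacian (\<lambda>z. f z u) y - 8100 * (real CARD('n))\<^sup>2 / defect y ^ 4"
    show "\<exists>e>0. \<exists>a c. {y} \<times> {u-e..u} \<subseteq> K \<and> ball y e \<times> {u} \<subseteq> K \<and>
        ((\<lambda>t. f y t - barrier y t) has_real_derivative a) (at u within {u-e..u}) \<and>
        (\<forall>i. has_second_deriv0 (\<lambda>s. f (y + s *\<^sub>R axis i 1) u - barrier (y + s *\<^sub>R axis i 1) u) (c i)) \<and>
        a < (\<Sum>i\<in>UNIV. c i)"
    proof (rule exI[of _ e], rule conjI, rule e(1), rule exI[of _ a], rule exI[of _ c], intro conjI allI)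
      have "90 * real CARD('n) * s \<le> (defect y)\<^sup>2" if "s \<le> u" for s
        using that qu by (smt (verit) mult_left_mono of_nat_0_le_iff mult_nonneg_nonneg)
      then show "{y} \<times> {u-e..u} \<subseteq> K"
        using sub y(1) by (auto simp: K_def)
      have "ball y e \<subseteq> V" using r(2) subset_ball[OF e(2), of y] by (rule order_trans[rotated])
      then show "ball y e \<times> {u} \<subseteq> K"
      proof (intro subsetI, clarify)
        fix z assume "z \<in> ball y e"
        then have "z \<in> V" using \<open>ball y e \<subseteq> V\<close> by blast
        then show "(z, u) \<in> K" using u unfolding K_def V_def by simp
      qed
      have "(f y has_real_derivative laplacian (\<lambda>z. f z u) y) (at u within {u-e..u})"
        by (rule DERIV_subset[OF heat[OF y1(2)] sub]) (use u in simp)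
      moreover have "(barrier y has_real_derivative 8100 * (real CARD('n))\<^sup>2 / defect y ^ 4) (at u within {u-e..u})"
      proof -
        have "((\<lambda>t. A + B * t / C) has_real_derivative B / C) (at u within {u-e..u})"
          if "C > 0" for A B C :: real
          using that by (auto intro!: derivative_eq_intros)
        then show ?thesis unfolding barrier_def using y(2) by simp
      qed
      ultimately show "((\<lambda>t. f y t - barrier y t) has_real_derivative a) (at u within {u-e..u})"
        unfolding a_def by (rule DERIV_diff)
      show "has_second_deriv0 (\<lambda>s. f (y + s *\<^sub>R axis i 1) u - barrier (y + s *\<^sub>R axis i 1) u) (c i)" for i
        unfolding c_def using u y y1
        by (intro has_second_deriv0_diff smooth_imp_second_partial_deriv[OF smooth] barrier_second_deriv) auto
      show "a < (\<Sum>i\<in>UNIV. c i)"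
        using barrier_strict_supersolution[OF y(2) u(1) qu]
        unfolding a_def c_def laplacian_def sum_subtractf by simp
    qed
  qed
  then show ?thesis by simp
qed

section \<open>The estimate\<close>

theorem lemma2p1:
  fixes f :: "real ^ 'n::finite \<Rightarrow> real \<Rightarrow> real"
  assumes smooth: "smooth_on (ball 0 2 \<times> {0..1}) (\<lambda>(x, t). f x t)"
    and heat: "\<And>x t. x \<in> ball 0 2 \<Longrightarrow> t \<in> {0..1} \<Longrightarrow>
      ((\<lambda>s. f x s) has_real_derivative laplacian (\<lambda>y. f y t) x) (at t within {0..1})"
    and decay: "\<And>x t. x \<in> ball 0 1 \<Longrightarrow> t \<in> {0..1} \<Longrightarrow> f x t * t \<le> 1"
    and nonneg: "\<And>x t. x \<in> ball 0 2 \<Longrightarrow> t \<in> {0..1} \<Longrightarrow> f x t \<ge> 0"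
    and initial: "(SUP x\<in>cball 0 1. f x 0 * (1 - (norm x)\<^sup>2)\<^sup>2) \<le> 1"
  shows "\<forall>t\<in>{0..1}. (SUP x\<in>cball 0 1. f x t * ((1 - (norm x)\<^sup>2)\<^sup>2 - 50 * real CARD('n) * t))
           \<le> 50 * real CARD('n)"
proof (intro ballI cSUP_least)
  show "cball (0 :: real ^ 'n) 1 \<noteq> {}" by simp
next
  fix t :: real and x :: "real ^ 'n"
  assume t: "t \<in> {0..1}" and x: "x \<in> cball 0 1"
  define W where "W = (1 - (norm x)\<^sup>2)\<^sup>2 - 50 * real CARD('n) * t"
  have x2: "x \<in> ball 0 2" using x by auto
  have f0: "f x t \<ge> 0" using nonneg[OF x2 t] .
  have "f x t * W \<le> 50 * real CARD('n)"
  proof (cases "W \<le> 0")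
    case True
    then have "f x t * W \<le> 0" using f0 by (simp add: mult_nonneg_nonpos)
    then show ?thesis by (smt (verit) of_nat_0_le_iff)
  next
    case False
    have "norm x \<noteq> 1"
    proof
      assume "norm x = 1"
      then have "W \<le> 0" using t by (simp add: W_def)
      then show False using False by simp
    qed
    then have x1: "x \<in> ball 0 1" using x by simp
    then have dx: "defect x > 0"
      by (simp add: defect_def abs_square_less_1)
    show ?thesis
    proof (cases "90 * real CARD('n) * t \<le> (defect x)\<^sup>2")
      case True
      have "Ck_on 0 (ball 0 2 \<times> {0..1}) (\<lambda>(x, t). f x t)"
        using smooth unfolding smooth_on_def by blast
      then have "continuous_on (ball 0 2 \<times> {0..1}) (\<lambda>(x, t). f x t)" by simp
      then have "continuous_on (cball 0 1) (\<lambda>x. (\<lambda>(x, t). f x t) (x, 0::real))"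
        by (rule continuous_on_compose2) (auto intro!: continuous_intros)
      then have "continuous_on (cball 0 1) (\<lambda>x. f x 0 * (1 - (norm x)\<^sup>2)\<^sup>2)"
        by (auto intro!: continuous_intros)
      \<comment> \<open>Boundedness is what lets a bound on the supremum of a set of reals bound its elements.\<close>
      then have "bdd_above ((\<lambda>x. f x 0 * (1 - (norm x)\<^sup>2)\<^sup>2) ` cball 0 1)"
        by (intro bounded_imp_bdd_above compact_imp_bounded compact_continuous_image compact_cball)
      then have "f z 0 * (defect z)\<^sup>2 \<le> 1" if "z \<in> ball 0 1" for z
        using that cSUP_upper[of z "cball 0 1" "\<lambda>x. f x 0 * (1 - (norm x)\<^sup>2)\<^sup>2"] initial
        unfolding defect_def by force
      then have "f x t \<le> barrier x t"
        by (intro heat_le_barrier[OF smooth heat decay]) (use x1 t True in auto)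
      then have "f x t * W \<le> barrier x t * W" using False by (simp add: mult_right_mono)
      also have "\<dots> \<le> 50 * real CARD('n)"
        using barrier_times_weight_le[OF dx, of t] False unfolding W_def defect_def by simp
      finally show ?thesis .
    next
      case far: False
      have "real CARD('n) * t \<ge> 0" using t by simp
      with far have "W \<le> 50 * real CARD('n) * t"
        unfolding W_def defect_def mult.assoc by linarith
      then have "f x t * W \<le> f x t * (50 * real CARD('n) * t)"
        using f0 by (rule mult_left_mono)
      also have "\<dots> = 50 * real CARD('n) * (f x t * t)" by simp
      also have "\<dots> \<le> 50 * real CARD('n) * 1"
        using decay[OF x1 t] by (rule mult_left_mono) simp
      finally show ?thesis by simp
    qed
  qed
  then show "f x t * ((1 - (norm x)\<^sup>2)\<^sup>2 - 50 * real CARD('n) * t) \<le> 50 * real CARD('n)"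
    by (simp add: W_def)
qed

end
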